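(* Let $u_1,u_2\in M_n(\mathbb C)$ be unitary matrices and let $u=\begin{bmatrix}u_1&0\\0&u_2\end{bmatrix}\in\Delta_2\otimes M_n(\mathbb C)=M_n(\mathbb C)\oplus M_n(\mathbb C)$. For the subalgebras $M_n(\mathbb C)$ (embedded diagonally) and $uM_n(\mathbb C)u^*$ of $M_n(\mathbb C)\oplus M_n(\mathbb C)$: (a) $\lambda\big(M_n(\mathbb C),uM_n(\mathbb C)u^*\big)=1$ if and only if $u_1^*u_2$ is a scalar matrix; (b) if $u_1^*u_2$ is not a diagonal matrix, then $\lambda\big(M_n(\mathbb C),uM_n(\mathbb C)u^*\big)=\frac12$.
   Context: $\Delta_2\subset M_2(\mathbb C)$ is the diagonal subalgebra. $M_n(\mathbb C)$ is embedded in $M_n(\mathbb C)\oplus M_n(\mathbb C)$ by $x\mapsto(x,x)$, and $M_n(\mathbb C)\oplus M_n(\mathbb C)$ carries the trace $\tau(x,y)=\frac12(tr(x)+tr(y))$ with $tr$ the normalized trace. For von Neumann subalgebras $\mathcal P,\mathcal Q$ of a finite von Neumann algebra $\mathcal M$ with fixed faithful normal trace and trace-preserving conditional expectation $E^{\mathcal M}_{\mathcal Q}$, the Pimsner-Popa constant is $\lambda(\mathcal P,\mathcal Q)=\sup\{t\ge0:E^{\mathcal M}_{\mathcal Q}(x)\ge tx\ \ \forall x\in\mathcal P_+\}$. *)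

theory Defs
  imports "HOL-Analysis.Analysis"
begin

type_synonym 'n cmat = "complex^'n^'n"

definition mat_adj :: "'n::finite cmat \<Rightarrow> 'n cmat" where
  "mat_adj A = map_matrix cnj (transpose A)"

definition unitary_mat :: "'n::finite cmat \<Rightarrow> bool" where
  "unitary_mat A \<longleftrightarrow> mat_adj A ** A = mat 1 \<and> A ** mat_adj A = mat 1"

definition scalar_mat :: "'n::finite cmat \<Rightarrow> bool" where
  "scalar_mat A \<longleftrightarrow> (\<exists>c. A = mat c)"

definition diagonal_mat :: "'n::finite cmat \<Rightarrow> bool" where
  "diagonal_mat A \<longleftrightarrow> (\<forall>i j. i \<noteq> j \<longrightarrow> A $ i $ j = 0)"

text \<open>Over the complex numbers a form that takes only nonnegative real values is automatically
  Hermitian, so self-adjointness need not be required separately.\<close>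

definition pos_semidef :: "'n::finite cmat \<Rightarrow> bool" where
  "pos_semidef A \<longleftrightarrow> (\<forall>v :: complex^'n. (\<Sum>i\<in>UNIV. (A *v v) $ i * cnj (v $ i)) \<in> \<real>\<^sub>\<ge>\<^sub>0)"

definition ntrace :: "'n::finite cmat \<Rightarrow> complex" where
  "ntrace A = trace A / of_nat CARD('n)"

text \<open>The direct sum of two copies of the matrix algebra is the type of pairs of matrices.
  Addition, subtraction and real scalar multiplication are the componentwise
  library operations on pairs; the type carries no library multiplication.\<close>

type_synonym 'n dsum = "'n cmat \<times> 'n cmat"

definition ds_mult :: "'n::finite dsum \<Rightarrow> 'n dsum \<Rightarrow> 'n dsum"  (infixl \<open>\<odot>\<close> 70) where
  "a \<odot> b = (fst a ** fst b, snd a ** snd b)"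

definition ds_adj :: "'n::finite dsum \<Rightarrow> 'n dsum" where
  "ds_adj a = (mat_adj (fst a), mat_adj (snd a))"

definition ds_scale :: "complex \<Rightarrow> 'n::finite dsum \<Rightarrow> 'n dsum" where
  "ds_scale c a = (map_matrix ((*) c) (fst a), map_matrix ((*) c) (snd a))"

definition ds_pos :: "'n::finite dsum \<Rightarrow> bool" where
  "ds_pos a \<longleftrightarrow> pos_semidef (fst a) \<and> pos_semidef (snd a)"

definition ds_le :: "'n::finite dsum \<Rightarrow> 'n dsum \<Rightarrow> bool" where
  "ds_le a b \<longleftrightarrow> ds_pos (b - a)"

definition ds_trace :: "'n::finite dsum \<Rightarrow> complex" where
  "ds_trace a = (ntrace (fst a) + ntrace (snd a)) / 2"

text \<open>The trace-preserving conditional expectation onto a von Neumann subalgebra. In finite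
  dimension the von Neumann subalgebras are exactly the unital star-subalgebras, and every
  linear map is normal, so no topological condition is imposed.\<close>

definition is_cond_exp :: "'n::finite dsum set \<Rightarrow> ('n dsum \<Rightarrow> 'n dsum) \<Rightarrow> bool" where
  "is_cond_exp Q E \<longleftrightarrow>
     (\<forall>x y. E (x + y) = E x + E y) \<and>
     (\<forall>c x. E (ds_scale c x) = ds_scale c (E x)) \<and>
     (\<forall>x. E x \<in> Q) \<and>
     (\<forall>q\<in>Q. E q = q) \<and>
     (\<forall>a\<in>Q. \<forall>b\<in>Q. \<forall>x. E (a \<odot> x \<odot> b) = a \<odot> E x \<odot> b) \<and>
     (\<forall>x. ds_pos x \<longrightarrow> ds_pos (E x)) \<and>
     (\<forall>x. ds_trace (E x) = ds_trace x)"

text \<open>Exists and is unique when \<^term>\<open>Q\<close> is a von Neumann subalgebra; the value is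
  unspecified otherwise.\<close>

definition cond_exp :: "'n::finite dsum set \<Rightarrow> 'n dsum \<Rightarrow> 'n dsum" where
  "cond_exp Q = (THE E. is_cond_exp Q E)"

text \<open>For von Neumann subalgebras the set below contains 0 and, the unit being in \<^term>\<open>P\<close>,
  is bounded by 1, so the supremum may be taken in the reals.\<close>

definition pimsner_popa :: "'n::finite dsum set \<Rightarrow> 'n dsum set \<Rightarrow> real" where
  "pimsner_popa P Q =
     Sup {t. 0 \<le> t \<and> (\<forall>x\<in>P. ds_pos x \<longrightarrow> ds_le (t *\<^sub>R x) (cond_exp Q x))}"

definition diag_alg :: "'n::finite dsum set" where
  "diag_alg = range (\<lambda>x. (x, x))"

definition conj_alg :: "'n::finite dsum \<Rightarrow> 'n dsum set \<Rightarrow> 'n dsum set" where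
  "conj_alg u P = (\<lambda>x. u \<odot> x \<odot> ds_adj u) ` P"

end

theory Submission
  imports Defs
begin

text \<open>
  Write \<open>Q\<close> for the conjugated algebra and \<open>W = u1* u2\<close>. Every element of \<open>Q\<close> has the form
  \<open>(u1 y u1*, u2 y u2*)\<close>, and the trace-preserving conditional expectation onto \<open>Q\<close> sends
  \<open>(a, b)\<close> to the element whose parameter is the average \<open>y = (u1* a u1 + u2* b u2) / 2\<close>.
  It is the only one, because such an expectation is determined by the pairings
  \<open>\<tau>(E(x) q) = \<tau>(x q)\<close> with \<open>q \<in> Q\<close> and the trace is faithful (\<open>is_cond_exp_unique\<close>,
  \<open>cond_exp_conj_alg\<close>).

  Take \<open>x \<ge> 0\<close> and put \<open>z = u1* x u1\<close>. Conjugating by \<open>u\<close>, the inequality \<open>E(x, x) \<ge> t (x, x)\<close>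
  becomes the pair \<open>W* z W \<ge> s z\<close> and \<open>z \<ge> s W* z W\<close> with \<open>s = 2 t - 1\<close>, so \<open>t = 1/2\<close> is always
  admissible. Some \<open>t > 1/2\<close> is admissible only if \<open>W* z W \<ge> s z\<close> for one \<open>s > 0\<close> and all
  \<open>z \<ge> 0\<close>. Testing this on positive rank-one matrices shows that \<open>W p\<close> is orthogonal to everything
  that \<open>p\<close> is orthogonal to, hence that every vector is an eigenvector of \<open>W\<close>, so \<open>W\<close> is scalar
  (\<open>scalar_mat_if_conj_dominates\<close>). Conversely, for scalar \<open>W\<close> the expectation fixes the
  diagonal copy of the matrix algebra. So the constant is \<open>1\<close> when \<open>W\<close> is scalar and \<open>1/2\<close>
  otherwise; both parts follow, since a non-diagonal matrix is not scalar.
\<close>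

section \<open>The Hermitian form and adjoints\<close>

definition herm :: "complex^'n \<Rightarrow> complex^'n \<Rightarrow> complex" where
  "herm v w = (\<Sum>i\<in>UNIV. v $ i * cnj (w $ i))"

lemma herm_add_left: "herm (a + b) v = herm a v + herm b v"
  by (simp add: herm_def sum.distrib distrib_right)

lemma herm_diff_left: "herm (a - b) v = herm a v - herm b v"
  by (simp add: herm_def sum_subtractf left_diff_distrib)

lemma herm_diff_right: "herm v (a - b) = herm v a - herm v b"
  by (simp add: herm_def sum_subtractf right_diff_distrib)

lemma herm_scaleR_left: "herm (t *\<^sub>R a) v = t *\<^sub>R herm a v"
  by (simp add: herm_def scaleR_sum_right)

lemma cnj_herm: "cnj (herm v w) = herm w v"
  by (simp add: herm_def mult.commute)

lemma herm_axis_right: "herm v (axis j 1) = v $ j"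
proof -
  have "herm v (axis j 1) = (\<Sum>i\<in>UNIV. if i = j then v $ i else 0)"
    unfolding herm_def by (rule sum.cong) (auto simp: axis_def)
  then show ?thesis by simp
qed

lemma herm_mult_left: "herm (A *v v) w = herm v (mat_adj A *v w)"
proof -
  have "herm (A *v v) w = (\<Sum>i\<in>UNIV. \<Sum>j\<in>UNIV. A $ i $ j * v $ j * cnj (w $ i))"
    by (simp add: herm_def matrix_vector_mult_def sum_distrib_right)
  also have "\<dots> = (\<Sum>j\<in>UNIV. \<Sum>i\<in>UNIV. A $ i $ j * v $ j * cnj (w $ i))"
    by (rule sum.swap)
  also have "\<dots> = herm v (mat_adj A *v w)"
    by (simp add: herm_def matrix_vector_mult_def mat_adj_def map_matrix_def transpose_def
        sum_distrib_left mult_ac)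
  finally show ?thesis .
qed

lemma mat_adj_nth: "mat_adj A $ i $ j = cnj (A $ j $ i)"
  by (simp add: mat_adj_def map_matrix_def transpose_def)

lemma mat_adj_mat_adj [simp]: "mat_adj (mat_adj A) = A"
  by (simp add: vec_eq_iff mat_adj_nth)

lemma mat_adj_mult: "mat_adj (A ** B) = mat_adj B ** mat_adj A"
  by (simp add: vec_eq_iff mat_adj_nth matrix_matrix_mult_def mult.commute)

lemma mat_adj_mat: "mat_adj (mat c) = mat (cnj c)"
  by (simp add: vec_eq_iff mat_adj_nth mat_def)

lemma scaleR_matrix_mult_left: "(r *\<^sub>R A) ** B = r *\<^sub>R (A ** (B :: 'n::finite cmat))"
  by (rule scalar_matrix_assoc[symmetric])

lemma scaleR_matrix_mult_right: "A ** (r *\<^sub>R B) = r *\<^sub>R (A ** (B :: 'n::finite cmat))"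
  by (simp add: matrix_scalar_ac scaleR_matrix_mult_left)

lemma matrix_add_rdistrib: "(A + B) ** C = A ** C + B ** (C :: 'n::finite cmat)"
  by (simp add: vec_eq_iff matrix_matrix_mult_def sum.distrib distrib_right)

lemma matrix_diff_ldistrib: "A ** (B - C) = A ** B - A ** (C :: 'n::finite cmat)"
  by (simp add: vec_eq_iff matrix_matrix_mult_def sum_subtractf right_diff_distrib)

lemma matrix_diff_rdistrib: "(A - B) ** C = A ** C - B ** (C :: 'n::finite cmat)"
  by (simp add: vec_eq_iff matrix_matrix_mult_def sum_subtractf left_diff_distrib)

lemma scale_matrix_mult_left:
  "map_matrix ((*) c) A ** B = map_matrix ((*) c) (A ** (B :: 'n::finite cmat))"
  by (simp add: vec_eq_iff matrix_matrix_mult_def map_matrix_def sum_distrib_left mult_ac)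

lemma scale_matrix_mult_right:
  "A ** map_matrix ((*) c) B = map_matrix ((*) c) (A ** (B :: 'n::finite cmat))"
  by (simp add: vec_eq_iff matrix_matrix_mult_def map_matrix_def sum_distrib_left mult_ac)

lemma scale_matrix_add:
  "map_matrix ((*) c) (A + B) = map_matrix ((*) c) A + map_matrix ((*) c) (B :: 'n::finite cmat)"
  by (simp add: vec_eq_iff map_matrix_def distrib_left)

lemma scale_matrix_scaleR:
  "map_matrix ((*) c) (r *\<^sub>R A) = r *\<^sub>R map_matrix ((*) c) (A :: 'n::finite cmat)"
  by (simp add: vec_eq_iff map_matrix_def)

lemma scaleR_matrix_vector_mult: "(r *\<^sub>R A) *v v = r *\<^sub>R ((A :: 'n::finite cmat) *v v)"
  by (simp add: vec_eq_iff matrix_vector_mult_def scaleR_sum_right)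

lemma mat_matrix_mult: "mat c ** A = map_matrix ((*) c) (A :: 'n::finite cmat)"
  by (simp add: vec_eq_iff matrix_matrix_mult_def map_matrix_def mat_def if_distrib[of "\<lambda>x. x * _"]
      cong: if_cong)

lemma matrix_mult_mat: "A ** mat c = map_matrix ((*) c) (A :: 'n::finite cmat)"
  by (simp add: vec_eq_iff matrix_matrix_mult_def map_matrix_def mat_def if_distrib[of "\<lambda>x. _ * x"]
      mult.commute cong: if_cong)

text \<open>The reason why the trace is faithful.\<close>

lemma trace_mult_adj:
  "trace (A ** mat_adj A) = of_real (\<Sum>i\<in>UNIV. \<Sum>j\<in>UNIV. (cmod (A $ i $ j))\<^sup>2)"
  by (simp add: trace_def matrix_matrix_mult_def mat_adj_nth complex_norm_square del: of_real_power)

section \<open>Positive semidefinite matrices\<close>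

lemma pos_semidef_iff_herm: "pos_semidef A \<longleftrightarrow> (\<forall>v. herm (A *v v) v \<in> \<real>\<^sub>\<ge>\<^sub>0)"
  by (simp add: pos_semidef_def herm_def)

lemma pos_semidef_add: "pos_semidef A \<Longrightarrow> pos_semidef B \<Longrightarrow> pos_semidef (A + B)"
  by (simp add: pos_semidef_iff_herm matrix_vector_mult_add_rdistrib herm_add_left)

lemma pos_semidef_scaleR: "0 \<le> r \<Longrightarrow> pos_semidef A \<Longrightarrow> pos_semidef (r *\<^sub>R A)"
  by (simp add: pos_semidef_iff_herm scaleR_matrix_vector_mult herm_scaleR_left
      scaleR_conv_of_real[where 'a = complex])

lemma pos_semidef_conj: "pos_semidef A \<Longrightarrow> pos_semidef (C ** A ** mat_adj C)"
  by (simp add: pos_semidef_iff_herm herm_mult_left[of C] flip: matrix_vector_mul_assoc)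

lemma pos_semidef_conj': "pos_semidef A \<Longrightarrow> pos_semidef (mat_adj C ** A ** C)"
  using pos_semidef_conj[of A "mat_adj C"] by simp

definition rank_one :: "complex^'n \<Rightarrow> 'n::finite cmat" where
  "rank_one v = (\<chi> i j. v $ i * cnj (v $ j))"

lemma herm_rank_one: "herm (rank_one v *v w) w = of_real ((cmod (herm v w))\<^sup>2)"
proof -
  have "rank_one v *v w = herm w v *s v"
    by (simp add: vec_eq_iff rank_one_def matrix_vector_mult_def herm_def vector_scalar_mult_def
        sum_distrib_right sum_distrib_left mult_ac)
  then have "herm (rank_one v *v w) w = herm w v * herm v w"
    by (simp add: herm_def[of "_ *s _"] herm_def[of v w] sum_distrib_left mult.assoc)
  then show ?thesis
    by (simp add: complex_norm_square cnj_herm mult.commute del: of_real_power)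
qed

lemma pos_semidef_rank_one: "pos_semidef (rank_one v)"
  by (simp add: pos_semidef_iff_herm herm_rank_one del: of_real_power)

lemma pos_semidef_mat_iff: "pos_semidef (mat (of_real r) :: 'n::finite cmat) \<longleftrightarrow> 0 \<le> r"
proof
  have scaled: "mat (of_real r) = r *\<^sub>R (mat 1 :: 'n cmat)"
    by (simp add: vec_eq_iff mat_def) (simp add: scaleR_conv_of_real)
  show "0 \<le> r" if "pos_semidef (mat (of_real r) :: 'n cmat)"
  proof -
    have "herm (mat (of_real r) *v axis undefined 1) (axis undefined 1 :: complex^'n) \<in> \<real>\<^sub>\<ge>\<^sub>0"
      using that by (simp add: pos_semidef_iff_herm)
    then show ?thesis
      unfolding scaled scaleR_matrix_vector_mult herm_axis_right
      by (simp add: scaleR_conv_of_real[where 'a = complex])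
  qed
  have "herm v v \<in> \<real>\<^sub>\<ge>\<^sub>0" for v :: "complex^'n"
    by (simp add: herm_def complex_nonneg_Reals_iff sum_nonneg)
  then have "pos_semidef (mat 1 :: 'n cmat)"
    by (simp add: pos_semidef_iff_herm)
  then show "pos_semidef (mat (of_real r) :: 'n cmat)" if "0 \<le> r"
    unfolding scaled using that by (rule pos_semidef_scaleR[rotated])
qed

text \<open>If \<open>W p\<close> is orthogonal to the orthogonal complement of \<open>p\<close> for every \<open>p\<close>, then \<open>W\<close> is
  scalar: basis vectors give the vanishing of the off-diagonal entries, and the orthogonal
  vectors \<open>e\<^sub>i + e\<^sub>j\<close> and \<open>e\<^sub>i - e\<^sub>j\<close> the equality of the diagonal ones.\<close>

lemma scalar_mat_if_preserves_orthogonality: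
  fixes W :: "'n::finite cmat"
  assumes "\<And>p w. herm p w = 0 \<Longrightarrow> herm (W *v p) w = 0"
  shows "scalar_mat W"
proof -
  have col: "(W *v axis i 1) $ j = W $ j $ i" for i j
    by (simp add: matrix_vector_mult_def axis_def if_distrib[of "\<lambda>x. _ * x"] cong: if_cong)
  have off: "W $ j $ i = 0" if "i \<noteq> j" for i j
    using assms[of "axis i 1" "axis j 1"] that by (simp add: herm_axis_right col) (simp add: axis_def)
  have diag: "W $ i $ i = W $ j $ j" for i j
  proof (cases "i = j")
    case False
    have "herm (axis i 1 + axis j 1) (axis i 1 - axis j 1 :: complex^'n) = 0"
      using False by (simp add: herm_diff_right herm_axis_right) (simp add: axis_def)
    from assms[OF this] show ?thesis
      using False
      by (simp add: matrix_vector_right_distrib herm_diff_right herm_axis_right col off)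
  qed simp
  have "W = mat (W $ undefined $ undefined)"
    using off diag by (auto simp: vec_eq_iff mat_def)
  then show ?thesis unfolding scalar_mat_def ..
qed

text \<open>On a rank-one \<open>z = v v*\<close> the hypothesis says \<open>s |\<langle>v, w\<rangle>|\<^sup>2 \<le> |\<langle>W* v, w\<rangle>|\<^sup>2\<close>, so
  \<open>W* v \<bottom> w\<close> forces \<open>v \<bottom> w\<close>; choosing \<open>v = W p\<close> with \<open>W\<close> unitary turns this into the
  orthogonality condition above.\<close>

lemma scalar_mat_if_conj_dominates:
  fixes W :: "'n::finite cmat"
  assumes W: "mat_adj W ** W = mat 1" and "s > 0"
    and dom: "\<And>z. pos_semidef z \<Longrightarrow> pos_semidef (mat_adj W ** z ** W - s *\<^sub>R z)"
  shows "scalar_mat W"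
proof (rule scalar_mat_if_preserves_orthogonality)
  fix p w :: "complex^'n"
  assume pw: "herm p w = 0"
  define v where "v = W *v p"
  have "mat_adj W *v v = p"
    by (simp add: v_def matrix_vector_mul_assoc W)
  then have Wv: "herm v (W *v w) = 0"
    using herm_mult_left[of "mat_adj W" v w] pw by simp
  have "herm ((mat_adj W ** rank_one v ** W - s *\<^sub>R rank_one v) *v w) w \<in> \<real>\<^sub>\<ge>\<^sub>0"
    using dom[OF pos_semidef_rank_one] by (simp add: pos_semidef_iff_herm)
  then have "herm (rank_one v *v (W *v w)) (W *v w) - s *\<^sub>R herm (rank_one v *v w) w \<in> \<real>\<^sub>\<ge>\<^sub>0"
    by (simp add: matrix_vector_mult_diff_rdistrib herm_diff_left scaleR_matrix_vector_mult
        herm_scaleR_left herm_mult_left[of "mat_adj W"] flip: matrix_vector_mul_assoc)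
  then have "complex_of_real (- (s * (cmod (herm v w))\<^sup>2)) \<in> \<real>\<^sub>\<ge>\<^sub>0"
    unfolding herm_rank_one Wv by (simp add: scaleR_conv_of_real)
  then have "s * (cmod (herm v w))\<^sup>2 \<le> 0"
    by (simp only: nonneg_Reals_of_real_iff neg_0_le_iff_le)
  with \<open>s > 0\<close> show "herm (W *v p) w = 0"
    by (simp add: v_def mult_le_0_iff)
qed

section \<open>Uniqueness of the conditional expectation\<close>

lemma ds_trace_add: "ds_trace (a + b) = ds_trace a + ds_trace b"
  by (simp add: ds_trace_def ntrace_def trace_add add_divide_distrib)

lemma ds_trace_faithful:
  fixes d :: "'n::finite dsum"
  assumes "ds_trace (d \<odot> ds_adj d) = 0"
  shows "d = 0"
proof -
  define S :: "'n cmat \<Rightarrow> real"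
    where "S A = (\<Sum>i\<in>UNIV. \<Sum>j\<in>UNIV. (cmod (A $ i $ j))\<^sup>2)" for A
  have nn: "S A \<ge> 0" for A :: "'n cmat"
    unfolding S_def by (intro sum_nonneg) simp
  have zero: "A = 0" if "S A = 0" for A :: "'n cmat"
    using that by (simp add: S_def sum_nonneg_eq_0_iff sum_nonneg vec_eq_iff)
  have "of_real (S (fst d) + S (snd d)) = (0::complex)"
    using assms
    by (simp add: ds_trace_def ntrace_def ds_mult_def ds_adj_def trace_mult_adj S_def
        flip: add_divide_distrib)
  then have "S (fst d) + S (snd d) = 0"
    by (simp only: of_real_eq_0_iff)
  then have "S (fst d) = 0" "S (snd d) = 0"
    using nn[of "fst d"] nn[of "snd d"] by linarith+
  then show ?thesis by (simp add: zero prod_eq_iff)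
qed

lemma ds_mult_diff_left: "(a - b) \<odot> c = a \<odot> c - b \<odot> c"
  by (simp add: ds_mult_def prod_eq_iff matrix_diff_rdistrib)

text \<open>Two trace-preserving bimodule maps onto \<open>Q\<close> have the same pairings \<open>\<tau>(E(x) q) = \<tau>(x q)\<close>
  with every \<open>q \<in> Q\<close>. Pairing their difference \<open>d\<close> at \<open>x\<close> with \<open>d*\<close>, which lies in \<open>Q\<close>, makes
  \<open>d\<close> vanish by faithfulness.\<close>

lemma is_cond_exp_unique:
  assumes E: "is_cond_exp Q E" and F: "is_cond_exp Q F"
    and one: "(mat 1, mat 1) \<in> Q"
    and diff: "\<And>a b. a \<in> Q \<Longrightarrow> b \<in> Q \<Longrightarrow> a - b \<in> Q"
    and adj: "\<And>a. a \<in> Q \<Longrightarrow> ds_adj a \<in> Q"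
  shows "E = F"
proof
  fix x
  have pairing: "ds_trace (G x \<odot> q) = ds_trace (x \<odot> q)" if G: "is_cond_exp Q G" and "q \<in> Q" for G q
  proof -
    have "G ((mat 1, mat 1) \<odot> x \<odot> q) = (mat 1, mat 1) \<odot> G x \<odot> q"
      using G one \<open>q \<in> Q\<close> unfolding is_cond_exp_def by blast
    then have "G (x \<odot> q) = G x \<odot> q"
      by (simp add: ds_mult_def)
    moreover have "ds_trace (G y) = ds_trace y" for y
      using G unfolding is_cond_exp_def by blast
    ultimately show ?thesis by metis
  qed
  define d where "d = E x - F x"
  have "d \<in> Q"
    using E F unfolding d_def is_cond_exp_def by (intro diff) blast+
  then have "ds_adj d \<in> Q" by (rule adj)
  then have "ds_trace (E x \<odot> ds_adj d) = ds_trace (F x \<odot> ds_adj d)"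
    using pairing[OF E] pairing[OF F] by simp
  moreover have "ds_trace (d \<odot> ds_adj d) + ds_trace (F x \<odot> ds_adj d) = ds_trace (E x \<odot> ds_adj d)"
    unfolding ds_trace_add[symmetric] by (simp add: d_def ds_mult_diff_left)
  ultimately have "ds_trace (d \<odot> ds_adj d) = 0" by simp
  then show "E x = F x"
    using ds_trace_faithful d_def by fastforce
qed

section \<open>The expectation onto the conjugated algebra\<close>

text \<open>\<open>spread\<close> parametrises the algebra \<open>u M u*\<close>, and \<open>avg\<close> is the trace adjoint of \<open>spread\<close>.\<close>

definition spread :: "'n::finite cmat \<Rightarrow> 'n cmat \<Rightarrow> 'n cmat \<Rightarrow> 'n dsum" where
  "spread u1 u2 y = (u1 ** y ** mat_adj u1, u2 ** y ** mat_adj u2)"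

definition avg :: "'n::finite cmat \<Rightarrow> 'n cmat \<Rightarrow> 'n dsum \<Rightarrow> 'n cmat" where
  "avg u1 u2 x = (1/2) *\<^sub>R (mat_adj u1 ** fst x ** u1 + mat_adj u2 ** snd x ** u2)"

lemma conj_alg_eq_range_spread: "conj_alg (u1, u2) diag_alg = range (spread u1 u2)"
  by (simp add: conj_alg_def diag_alg_def spread_def[abs_def] ds_mult_def ds_adj_def image_image)

lemma unitary_cancel:
  assumes "unitary_mat u"
  shows "mat_adj u ** u = mat 1" "u ** mat_adj u = mat 1"
    "mat_adj u ** (u ** A) = A" "u ** (mat_adj u ** A) = A"
  using assms by (simp_all add: unitary_mat_def matrix_mul_assoc)

lemma spread_diff: "spread u1 u2 a - spread u1 u2 b = spread u1 u2 (a - b)"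
  by (simp add: spread_def matrix_diff_rdistrib matrix_diff_ldistrib)

lemma spread_adj: "ds_adj (spread u1 u2 a) = spread u1 u2 (mat_adj a)"
  by (simp add: spread_def ds_adj_def mat_adj_mult matrix_mul_assoc)

lemma ds_trace_spread:
  assumes "unitary_mat u1" "unitary_mat u2"
  shows "ds_trace (spread u1 u2 y) = ntrace y"
proof -
  have "trace (u ** y ** mat_adj u) = trace y" if "unitary_mat u" for u
    using trace_mul_sym[of "u ** y" "mat_adj u"] by (simp add: unitary_cancel[OF that])
  then show ?thesis
    using assms by (simp add: ds_trace_def spread_def ntrace_def)
qed

lemma ntrace_avg:
  assumes "unitary_mat u1" "unitary_mat u2"
  shows "ntrace (avg u1 u2 x) = ds_trace x"
proof -
  have "trace (mat_adj u ** a ** u) = trace a" if "unitary_mat u" for u a :: "'a cmat"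
    using trace_mul_sym[of "mat_adj u ** a" u]
    by (simp add: matrix_mul_assoc unitary_cancel[OF that])
  moreover have "trace (r *\<^sub>R A) = of_real r * trace A" for r and A :: "'a cmat"
    unfolding trace_def by (simp add: scaleR_conv_of_real[where 'a = complex] sum_distrib_left)
  ultimately show ?thesis
    using assms by (simp add: ds_trace_def avg_def ntrace_def trace_add
        add_divide_distrib mult.commute)
qed

lemma avg_spread:
  assumes "unitary_mat u1" "unitary_mat u2"
  shows "avg u1 u2 (spread u1 u2 y) = y"
  using assms by (simp add: avg_def spread_def unitary_cancel flip: matrix_mul_assoc)

lemma avg_bimodule:
  assumes "unitary_mat u1" "unitary_mat u2"
  shows "avg u1 u2 (spread u1 u2 a \<odot> x \<odot> spread u1 u2 b) = a ** avg u1 u2 x ** b"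
  using assms
  by (simp add: avg_def spread_def ds_mult_def unitary_cancel scaleR_matrix_mult_left
      scaleR_matrix_mult_right matrix_add_ldistrib matrix_add_rdistrib flip: matrix_mul_assoc)

lemma spread_mult:
  assumes "unitary_mat u1" "unitary_mat u2"
  shows "spread u1 u2 a \<odot> spread u1 u2 b = spread u1 u2 (a ** b)"
  using assms by (simp add: spread_def ds_mult_def unitary_cancel flip: matrix_mul_assoc)

lemma is_cond_exp_spread_avg:
  assumes u: "unitary_mat u1" "unitary_mat u2"
  shows "is_cond_exp (range (spread u1 u2)) (\<lambda>x. spread u1 u2 (avg u1 u2 x))"
  unfolding is_cond_exp_def
proof (intro conjI allI ballI impI)
  fix x y :: "'a dsum" and c
  show "spread u1 u2 (avg u1 u2 (x + y)) = spread u1 u2 (avg u1 u2 x) + spread u1 u2 (avg u1 u2 y)"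
    by (simp add: spread_def avg_def matrix_add_ldistrib matrix_add_rdistrib scaleR_matrix_mult_left
      scaleR_matrix_mult_right scaleR_add_right)
  show "spread u1 u2 (avg u1 u2 (ds_scale c x)) = ds_scale c (spread u1 u2 (avg u1 u2 x))"
    by (simp add: spread_def avg_def ds_scale_def scale_matrix_mult_left scale_matrix_mult_right
        scaleR_matrix_mult_left scaleR_matrix_mult_right scale_matrix_add scale_matrix_scaleR
        matrix_add_ldistrib matrix_add_rdistrib)
  show "ds_trace (spread u1 u2 (avg u1 u2 x)) = ds_trace x"
    by (simp add: ds_trace_spread ntrace_avg u)
next
  fix x :: "'a dsum"
  assume "ds_pos x"
  then have "pos_semidef (avg u1 u2 x)"
    unfolding avg_def ds_pos_def
    by (intro pos_semidef_scaleR pos_semidef_add pos_semidef_conj') auto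
  then show "ds_pos (spread u1 u2 (avg u1 u2 x))"
    by (simp add: ds_pos_def spread_def pos_semidef_conj)
next
  fix a b x
  assume "a \<in> range (spread u1 u2)" "b \<in> range (spread u1 u2)"
  then show "spread u1 u2 (avg u1 u2 (a \<odot> x \<odot> b)) = a \<odot> spread u1 u2 (avg u1 u2 x) \<odot> b"
    by (auto simp: avg_bimodule spread_mult u)
qed (auto simp: avg_spread u)

lemma cond_exp_conj_alg:
  assumes u: "unitary_mat u1" "unitary_mat u2"
  shows "cond_exp (conj_alg (u1, u2) diag_alg) x = spread u1 u2 (avg u1 u2 x)"
proof -
  let ?Q = "range (spread u1 u2)"
  have "(mat 1, mat 1) = spread u1 u2 (mat 1)"
    by (simp add: spread_def unitary_cancel u)
  then have one: "(mat 1, mat 1) \<in> ?Q" by blast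
  have "cond_exp ?Q = (\<lambda>x. spread u1 u2 (avg u1 u2 x))"
    unfolding cond_exp_def
  proof (rule the_equality)
    show E: "is_cond_exp ?Q (\<lambda>x. spread u1 u2 (avg u1 u2 x))"
      by (rule is_cond_exp_spread_avg[OF u])
    show "F = (\<lambda>x. spread u1 u2 (avg u1 u2 x))" if "is_cond_exp ?Q F" for F
      by (rule is_cond_exp_unique[OF that E one]) (auto simp: spread_diff spread_adj)
  qed
  then show ?thesis by (simp add: conj_alg_eq_range_spread)
qed

section \<open>The Pimsner-Popa constant\<close>

definition admissible :: "'n::finite cmat \<Rightarrow> 'n cmat \<Rightarrow> real \<Rightarrow> bool" where
  "admissible u1 u2 t \<longleftrightarrow> 0 \<le> t \<and>
     (\<forall>x. pos_semidef x \<longrightarrow> ds_le (t *\<^sub>R (x, x)) (spread u1 u2 (avg u1 u2 (x, x))))"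

lemma pimsner_popa_eq_Sup_admissible:
  assumes "unitary_mat u1" "unitary_mat u2"
  shows "pimsner_popa diag_alg (conj_alg (u1, u2) diag_alg) = Sup {t. admissible u1 u2 t}"
  unfolding pimsner_popa_def
  unfolding cond_exp_conj_alg[OF assms] by (simp add: admissible_def diag_alg_def ds_pos_def)

text \<open>The defect \<open>E(x, x) - (x, x) / 2\<close> has components \<open>V x V* / 2\<close> and \<open>V* x V / 2\<close> with
  \<open>V = u1 u2*\<close>.\<close>

lemma admissible_half:
  assumes u: "unitary_mat u1" "unitary_mat u2"
  shows "admissible u1 u2 (1/2)"
  unfolding admissible_def
proof (intro conjI allI impI)
  fix x :: "'a cmat"
  assume x: "pos_semidef x"
  have "spread u1 u2 (avg u1 u2 (x, x)) - (1/2) *\<^sub>R (x, x) =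
      ((1/2) *\<^sub>R (u1 ** (mat_adj u2 ** x ** u2) ** mat_adj u1),
       (1/2) *\<^sub>R (u2 ** (mat_adj u1 ** x ** u1) ** mat_adj u2))"
    using u by (simp add: spread_def avg_def unitary_cancel matrix_add_ldistrib matrix_add_rdistrib
        scaleR_matrix_mult_left scaleR_matrix_mult_right scaleR_add_right flip: matrix_mul_assoc)
  moreover have "pos_semidef ((1/2) *\<^sub>R (v ** (mat_adj w ** x ** w) ** mat_adj v))" for v w
    by (intro pos_semidef_scaleR pos_semidef_conj pos_semidef_conj' x) simp
  ultimately show "ds_le ((1/2) *\<^sub>R (x, x)) (spread u1 u2 (avg u1 u2 (x, x)))"
    by (simp add: ds_le_def ds_pos_def)
qed simp

lemma scalar_mat_if_admissible_gt_half:
  assumes u: "unitary_mat u1" "unitary_mat u2"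
    and adm: "admissible u1 u2 t" and "t > 1/2"
  shows "scalar_mat (mat_adj u1 ** u2)"
proof (rule scalar_mat_if_conj_dominates)
  let ?W = "mat_adj u1 ** u2"
  show "mat_adj ?W ** ?W = mat 1"
    using u by (simp add: mat_adj_mult unitary_cancel flip: matrix_mul_assoc)
  show "0 < 2 * t - 1" using \<open>t > 1/2\<close> by simp
  fix z :: "'a cmat"
  assume z: "pos_semidef z"
  define x where "x = u1 ** z ** mat_adj u1"
  have "pos_semidef x" unfolding x_def by (rule pos_semidef_conj[OF z])
  with adm have "pos_semidef (u1 ** avg u1 u2 (x, x) ** mat_adj u1 - t *\<^sub>R x)"
    by (simp add: admissible_def ds_le_def ds_pos_def spread_def)
  then have "pos_semidef (2 *\<^sub>R (mat_adj u1 ** (u1 ** avg u1 u2 (x, x) ** mat_adj u1 - t *\<^sub>R x) ** u1))"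
    by (intro pos_semidef_scaleR pos_semidef_conj') auto
  also have "2 *\<^sub>R (mat_adj u1 ** (u1 ** avg u1 u2 (x, x) ** mat_adj u1 - t *\<^sub>R x) ** u1)
      = 2 *\<^sub>R avg u1 u2 (x, x) - (2 * t) *\<^sub>R z"
    using u by (simp add: x_def unitary_cancel matrix_diff_ldistrib matrix_diff_rdistrib
        scaleR_matrix_mult_left scaleR_matrix_mult_right scaleR_diff_right flip: matrix_mul_assoc)
  also have "\<dots> = mat_adj ?W ** z ** ?W - (2 * t - 1) *\<^sub>R z"
    using u by (simp add: x_def avg_def mat_adj_mult unitary_cancel scaleR_left_diff_distrib
        flip: matrix_mul_assoc)
  finally show "pos_semidef (mat_adj ?W ** z ** ?W - (2 * t - 1) *\<^sub>R z)" .
qed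

text \<open>For \<open>u2 = c u1\<close> the phase \<open>c\<close> cancels in every conjugation, so the expectation fixes the
  diagonal copy of the matrix algebra.\<close>

lemma expectation_fixes_diagonal:
  assumes u: "unitary_mat u1" "unitary_mat u2" and "scalar_mat (mat_adj u1 ** u2)"
  shows "spread u1 u2 (avg u1 u2 (x, x)) = (x, x)"
proof -
  obtain c where c: "mat_adj u1 ** u2 = mat c"
    using assms(3) by (auto simp: scalar_mat_def)
  have u2: "u2 = map_matrix ((*) c) u1"
    using unitary_cancel(4)[OF u(1), of u2] by (simp add: c matrix_mult_mat)
  have adj_u2: "mat_adj u2 = map_matrix ((*) (cnj c)) (mat_adj u1)"
    by (simp add: u2 vec_eq_iff mat_adj_nth map_matrix_def)
  have "mat (c * cnj c) = (mat 1 :: 'a cmat)"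
  proof -
    have "mat (c * cnj c) = map_matrix ((*) c) (mat (cnj c) :: 'a cmat)"
      by (simp add: vec_eq_iff map_matrix_def mat_def)
    also have "\<dots> = mat c ** mat (cnj c)"
      by (simp add: mat_matrix_mult)
    also have "\<dots> = mat_adj u1 ** u2 ** mat_adj (mat_adj u1 ** u2)"
      by (simp add: c mat_adj_mat)
    also have "\<dots> = mat 1"
      using u by (simp add: mat_adj_mult unitary_cancel flip: matrix_mul_assoc)
    finally show ?thesis .
  qed
  then have phase: "c * cnj c = 1"
    by (simp add: vec_eq_iff mat_def) metis
  have cancel: "map_matrix ((*) c) (map_matrix ((*) (cnj c)) A) = A"
    "map_matrix ((*) (cnj c)) (map_matrix ((*) c) A) = A" for A :: "'a cmat"
    using phase by (simp_all add: vec_eq_iff map_matrix_def mult.commute[of "cnj c" c]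
        flip: mult.assoc)
  have conj2: "u2 ** y ** mat_adj u2 = u1 ** y ** mat_adj u1" for y
    unfolding adj_u2 unfolding u2
    by (simp add: scale_matrix_mult_left scale_matrix_mult_right cancel)
  have conj2': "mat_adj u2 ** y ** u2 = mat_adj u1 ** y ** u1" for y
    unfolding adj_u2 unfolding u2
    by (simp add: scale_matrix_mult_left scale_matrix_mult_right cancel)
  have "avg u1 u2 (x, x) = mat_adj u1 ** x ** u1"
    by (simp add: avg_def conj2' flip: scaleR_2)
  then show ?thesis
    unfolding spread_def conj2
    using u by (simp add: unitary_cancel flip: matrix_mul_assoc)
qed

lemma pimsner_popa_scalar:
  assumes u: "unitary_mat u1" "unitary_mat u2" and W: "scalar_mat (mat_adj u1 ** u2)"
  shows "pimsner_popa diag_alg (conj_alg (u1, u2) diag_alg) = 1"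
  unfolding pimsner_popa_eq_Sup_admissible[OF u]
proof (rule cSup_eq_maximum)
  have "pos_semidef (0 :: 'a cmat)"
    by (simp add: pos_semidef_def)
  then show "1 \<in> {t. admissible u1 u2 t}"
    by (simp add: admissible_def expectation_fixes_diagonal[OF u W] ds_le_def ds_pos_def)
  fix t
  assume "t \<in> {t. admissible u1 u2 t}"
  moreover have "pos_semidef (mat 1 :: 'a cmat)"
    using pos_semidef_mat_iff[of 1] by simp
  ultimately have "pos_semidef (mat 1 - t *\<^sub>R mat 1 :: 'a cmat)"
    by (simp add: admissible_def expectation_fixes_diagonal[OF u W] ds_le_def ds_pos_def)
  also have "mat 1 - t *\<^sub>R mat 1 = (mat (of_real (1 - t)) :: 'a cmat)"
    by (simp add: vec_eq_iff mat_def) (simp add: scaleR_conv_of_real)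
  finally show "t \<le> 1"
    by (simp only: pos_semidef_mat_iff diff_ge_0_iff_ge)
qed

lemma pimsner_popa_nonscalar:
  assumes u: "unitary_mat u1" "unitary_mat u2" and W: "\<not> scalar_mat (mat_adj u1 ** u2)"
  shows "pimsner_popa diag_alg (conj_alg (u1, u2) diag_alg) = 1 / 2"
  unfolding pimsner_popa_eq_Sup_admissible[OF u]
proof (rule cSup_eq_maximum)
  show "1/2 \<in> {t. admissible u1 u2 t}"
    using admissible_half[OF u] by simp
next
  fix t
  assume "t \<in> {t. admissible u1 u2 t}"
  then show "t \<le> 1/2"
    using scalar_mat_if_admissible_gt_half[OF u, of t] W by fastforce
qed

theorem theorem1p18:
  fixes u1 u2 :: "complex^'n^'n"
  assumes "unitary_mat u1" and "unitary_mat u2"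
  shows "(pimsner_popa diag_alg (conj_alg (u1, u2) diag_alg) = 1
            \<longleftrightarrow> scalar_mat (mat_adj u1 ** u2)) \<and>
         (\<not> diagonal_mat (mat_adj u1 ** u2) \<longrightarrow>
            pimsner_popa diag_alg (conj_alg (u1, u2) diag_alg) = 1 / 2)"
proof -
  have "scalar_mat A \<Longrightarrow> diagonal_mat A" for A :: "'n cmat"
    by (auto simp: scalar_mat_def diagonal_mat_def mat_def)
  then show ?thesis
    using pimsner_popa_scalar[OF assms] pimsner_popa_nonscalar[OF assms] by fastforce
qed

end
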